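(* Let $\alpha\in\overline{\mathbb{D}}$ and $\phi(z)=\alpha z$ for $z\in\mathbb{D}$. Then the Berezin range of the composition operator $C_\phi$ acting on the Bergman space $A^2(\mathbb{D})$ is convex if and only if $\alpha$ is real with $-1\le\alpha\le 1$.
   Context: $\mathbb{D}$ is the open unit disc in $\mathbb{C}$ and $\overline{\mathbb{D}}$ its closure. $A^2(\mathbb{D})$ is the Hilbert space of holomorphic functions $f$ on $\mathbb{D}$ with $\int_{\mathbb{D}}|f|^2\,dV<\infty$, where $dV$ is normalized area measure, with the $L^2(dV)$ inner product; its reproducing kernel at $w\in\mathbb{D}$ is $k_w(z)=\frac{1}{(1-\overline{w}z)^2}$. The normalized reproducing kernel is $\hat{k}_w=k_w/\|k_w\|$. The composition operator is $C_\phi f=f\circ\phi$. The Berezin range of a bounded operator $T$ on $A^2(\mathbb{D})$ is $\mathrm{Ber}(T)=\{\langle T\hat{k}_w,\hat{k}_w\rangle : w\in\mathbb{D}\}\subseteq\mathbb{C}$. *)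

theory Defs
  imports "HOL-Analysis.Analysis"
begin

abbreviation unit_disc :: "complex set" where
  "unit_disc \<equiv> ball 0 1"

definition disc_area :: "complex measure" where
  "disc_area = uniform_measure (lebesgue_on unit_disc) unit_disc"

text \<open>
  A function on the unit disc is represented by a total function that is extensional on the disc
  (it is \<open>undefined\<close> elsewhere), so that HOL equality of two elements of the Bergman space is
  equality on the disc.
\<close>

definition bergman_space :: "(complex \<Rightarrow> complex) set" where
  "bergman_space = {f \<in> extensional unit_disc.
     f holomorphic_on unit_disc \<and> integrable disc_area (\<lambda>z. (cmod (f z))\<^sup>2)}"

definition bergman_inner :: "(complex \<Rightarrow> complex) \<Rightarrow> (complex \<Rightarrow> complex) \<Rightarrow> complex" where
  "bergman_inner f g = (LINT z|disc_area. f z * cnj (g z))"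

definition bergman_norm :: "(complex \<Rightarrow> complex) \<Rightarrow> real" where
  "bergman_norm f = sqrt (LINT z|disc_area. (cmod (f z))\<^sup>2)"

definition bergman_kernel :: "complex \<Rightarrow> complex \<Rightarrow> complex" where
  "bergman_kernel w = (\<lambda>z\<in>unit_disc. 1 / (1 - cnj w * z)\<^sup>2)"

definition normalized_kernel :: "complex \<Rightarrow> complex \<Rightarrow> complex" where
  "normalized_kernel w =
     (\<lambda>z\<in>unit_disc. bergman_kernel w z / of_real (bergman_norm (bergman_kernel w)))"

text \<open>
  An operator on the Bergman space is a function on \<^term>\<open>bergman_space\<close>; its values at
  arguments outside that set are irrelevant.
\<close>

definition composition_operator ::
    "(complex \<Rightarrow> complex) \<Rightarrow> (complex \<Rightarrow> complex) \<Rightarrow> (complex \<Rightarrow> complex)" where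
  "composition_operator \<phi> = (\<lambda>f\<in>bergman_space. \<lambda>z\<in>unit_disc. f (\<phi> z))"

definition berezin_range :: "((complex \<Rightarrow> complex) \<Rightarrow> (complex \<Rightarrow> complex)) \<Rightarrow> complex set" where
  "berezin_range T =
     {bergman_inner (T (normalized_kernel w)) (normalized_kernel w) | w. w \<in> unit_disc}"

lemma emeasure_disc_area: "emeasure disc_area unit_disc = 1"
proof -
  have "emeasure (lebesgue_on unit_disc) unit_disc = emeasure lebesgue unit_disc"
    by (simp add: emeasure_restrict_space)
  moreover have "emeasure lebesgue unit_disc \<noteq> \<infinity>"
    using emeasure_lborel_ball_finite[of "0::complex" 1] by simp
  moreover have "emeasure lebesgue unit_disc \<noteq> 0"
    using open_not_negligible[of unit_disc] by (auto simp: negligible_iff_emeasure0)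
  ultimately show ?thesis
    unfolding disc_area_def by (intro emeasure_uniform_measure_1) (auto simp: sets_restrict_space)
qed

lemma cnj_mult_norm_le:
  assumes "w \<in> unit_disc" "z \<in> unit_disc"
  shows "cmod (cnj w * z) \<le> cmod w"
  using assms by (simp add: norm_mult mult_left_le)

lemma kernel_denominator_nonzero:
  assumes "w \<in> unit_disc" "z \<in> unit_disc"
  shows "1 - cnj w * z \<noteq> 0"
proof
  assume "1 - cnj w * z = 0"
  then have "cmod (cnj w * z) = 1" by (metis eq_iff_diff_eq_0 norm_one)
  then show False using cnj_mult_norm_le[OF assms] assms by simp
qed

lemma kernel_multiple_in_bergman_space:
  assumes w: "w \<in> unit_disc"
  shows "(\<lambda>z\<in>unit_disc. bergman_kernel w z / c) \<in> bergman_space"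
proof -
  let ?g = "\<lambda>z. 1 / (1 - cnj w * z)\<^sup>2 / c"
  let ?f = "\<lambda>z\<in>unit_disc. bergman_kernel w z / c"
  have eq: "?f z = ?g z" if "z \<in> unit_disc" for z
    using that by (simp add: bergman_kernel_def)
  have "?g holomorphic_on unit_disc"
    by (cases "c = 0") (use kernel_denominator_nonzero[OF w] in \<open>auto intro!: holomorphic_intros\<close>)
  then have hol: "?f holomorphic_on unit_disc"
    using eq by (metis (no_types, lifting) holomorphic_cong)
  have "continuous_on unit_disc (\<lambda>z. (cmod (?f z))\<^sup>2)"
    by (intro continuous_intros holomorphic_on_imp_continuous_on hol)
  then have meas: "(\<lambda>z. (cmod (?f z))\<^sup>2) \<in> borel_measurable disc_area"
    unfolding disc_area_def uniform_measure_def
    using continuous_imp_measurable_on_sets_lebesgue[of unit_disc] by simp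
  have bnd: "norm ((cmod (?f z))\<^sup>2) \<le> (1 / (1 - cmod w)\<^sup>2 / cmod c)\<^sup>2" if z: "z \<in> unit_disc" for z
  proof -
    have "1 - cmod w \<le> cmod (1 - cnj w * z)"
      using norm_triangle_ineq2[of 1 "cnj w * z"] cnj_mult_norm_le[OF w z] by simp
    then have "1 / (cmod (1 - cnj w * z))\<^sup>2 \<le> 1 / (1 - cmod w)\<^sup>2"
      using w by (intro frac_le power_mono) auto
    then have "1 / (cmod (1 - cnj w * z))\<^sup>2 / cmod c \<le> 1 / (1 - cmod w)\<^sup>2 / cmod c"
      by (rule divide_right_mono) simp
    then have "cmod (?g z) \<le> 1 / (1 - cmod w)\<^sup>2 / cmod c"
      by (simp only: norm_divide norm_power norm_one)
    then show ?thesis using eq[OF z] by (simp del: restrict_apply' add: power_mono)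
  qed
  have sp: "space disc_area = unit_disc"
    by (simp add: disc_area_def space_restrict_space)
  have "integrable disc_area (\<lambda>z. (cmod (?f z))\<^sup>2)"
  proof -
    interpret finite_measure disc_area
      by (rule finite_measureI) (simp add: sp emeasure_disc_area)
    show ?thesis
      by (rule integrable_const_bound[OF AE_I2 meas]) (rule bnd, simp only: sp)
  qed
  then show ?thesis using hol unfolding bergman_space_def by auto
qed

lemma bergman_kernel_in_bergman_space:
  "w \<in> unit_disc \<Longrightarrow> bergman_kernel w \<in> bergman_space"
  using kernel_multiple_in_bergman_space[of w 1] by (simp add: bergman_kernel_def cong: restrict_cong)

lemma normalized_kernel_in_bergman_space:
  "w \<in> unit_disc \<Longrightarrow> normalized_kernel w \<in> bergman_space"
  unfolding normalized_kernel_def by (rule kernel_multiple_in_bergman_space)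

end

theory Submission
  imports Defs
begin

text \<open>
  Expanding both kernels into power series and using \<open>\<integral> z\<^sup>n (cnj z)\<^sup>m = \<delta>\<^sub>n\<^sub>m / (n + 1)\<close> shows that the
  Berezin transform at \<open>w\<close> is \<open>((1 - t) / (1 - \<alpha> t))\<^sup>2\<close> with \<open>t = \<bar>w\<bar>\<^sup>2\<close>, so the Berezin range is a curve.
  For real \<open>\<alpha>\<close> it is a connected subset of the real line. Conversely, if the range is convex, it
  contains the segment from \<open>1\<close> (at \<open>t = 0\<close>) to the point \<open>p\<close> at \<open>t = 1/2\<close>, so the curve meets the line
  through \<open>1\<close> and \<open>p\<close> infinitely often; this being a polynomial condition on \<open>t\<close>, the whole curve
  lies on that line, including its limit \<open>0\<close> at \<open>t = 1\<close>. Hence \<open>p\<close> is real, which forces \<open>\<alpha>\<close> to be real.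
\<close>

section \<open>Rotation invariance of Lebesgue measure on the complex plane\<close>

text \<open>The identification pulls a box back to a box with the same side lengths, and Lebesgue
  measure is determined by the volumes of boxes.\<close>

lemma distr_lborel_Complex:
  "distr lborel borel (\<lambda>x::real^2. Complex (x $ 1) (x $ 2)) = lborel"
proof (rule lborel_eqI[symmetric])
  fix l u :: complex
  assume le: "\<And>b. b \<in> Basis \<Longrightarrow> l \<bullet> b \<le> u \<bullet> b"
  let ?P = "\<lambda>x::real^2. Complex (x $ 1) (x $ 2)"
  let ?J = "\<lambda>z. (\<chi> i. if i = 1 then Re z else Im z) :: real^2"
  have Basis2: "(Basis :: (real^2) set) = {axis 1 1, axis 2 1}"
    by (auto simp: Basis_vec_def) (metis exhaust_2)
  have [measurable]: "?P \<in> borel_measurable borel"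
    by (intro borel_measurable_continuous_onI) (auto intro!: continuous_intros simp: Complex_eq)
  have le': "Re l \<le> Re u" "Im l \<le> Im u"
    using le[of 1] le[of \<i>] by (auto simp: Basis_complex_def)
  have vi: "?P -` box l u = box (?J l) (?J u)"
    by (auto simp: mem_box_cart forall_2 in_box_complex_iff)
  show "emeasure (distr lborel borel ?P) (box l u) = (\<Prod>b\<in>Basis. (u - l) \<bullet> b)"
    using le' by (subst emeasure_distr)
      (auto simp: vi emeasure_lborel_box_eq Basis2 Basis_complex_def axis_eq_axis inner_axis)
qed simp

text \<open>
  The library knows that orthogonal maps preserve Lebesgue measure only on \<open>real^'n\<close>, so the
  rotation is transported to \<open>real^2\<close>.
\<close>

lemma distr_lborel_rotation:
  assumes "cmod \<omega> = 1"
  shows "distr lborel borel ((*) \<omega>) = lborel"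
proof (rule lborel_eqI[symmetric])
  fix l u :: complex
  assume le: "\<And>b. b \<in> Basis \<Longrightarrow> l \<bullet> b \<le> u \<bullet> b"
  let ?P = "\<lambda>x::real^2. Complex (x $ 1) (x $ 2)"
  let ?J = "\<lambda>z. (\<chi> i. if i = 1 then Re z else Im z) :: real^2"
  \<comment> \<open>Multiplication by \<open>\<omega>\<close> carried to \<open>real^2\<close>:
    linear and norm preserving, hence orthogonal.\<close>
  let ?R = "\<lambda>x. ?J (\<omega> * ?P x)"
  let ?B = "box l u"
  let ?A = "(*) \<omega> -` ?B"
  have P_meas [measurable]: "?P \<in> borel_measurable borel"
    by (intro borel_measurable_continuous_onI) (auto intro!: continuous_intros simp: Complex_eq)
  have PJ: "?P (?J z) = z" for z by (simp add: complex_eq_iff)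
  have JP: "?J (?P x) = x" for x by (simp add: vec_eq_iff forall_2)
  have normP: "norm x = cmod (?P x)" for x :: "real^2"
    by (simp add: norm_vec_def L2_set_def sum_2 cmod_def)
  have "linear ?R"
    by (rule linearI) (simp_all add: vec_eq_iff algebra_simps)
  moreover have "norm (?R x) = norm x" for x
    unfolding normP PJ using assms by (simp add: norm_mult)
  ultimately have R: "orthogonal_transformation ?R"
    by (simp add: orthogonal_transformation)
  \<comment> \<open>\<open>measure_orthogonal_image\<close> speaks of
    \<open>measure lebesgue\<close> on \<open>lmeasurable\<close> sets; boundedness supplies the
    finiteness that lets \<open>emeasure lborel\<close> be recovered from it.\<close>
  have em: "emeasure lborel S = ennreal (measure lebesgue (?P -` S))"
      and lm: "?P -` S \<in> lmeasurable" if S: "S \<in> sets borel" "bounded S" for S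
  proof -
    have S': "?P -` S \<in> sets borel"
      using measurable_sets[OF P_meas S(1)] by simp
    have "bounded (?P -` S)"
      using S(2) unfolding bounded_iff by (auto simp: normP)
    then show "?P -` S \<in> lmeasurable"
      using S' by (simp add: bounded_set_imp_lmeasurable)
    then have "emeasure lebesgue (?P -` S) = ennreal (measure lebesgue (?P -` S))"
      by (rule emeasure_eq_measure2)
    moreover have "emeasure lborel S = emeasure lborel (?P -` S)"
      using emeasure_distr[of ?P lborel borel S] S by (simp add: distr_lborel_Complex)
    ultimately show "emeasure lborel S = ennreal (measure lebesgue (?P -` S))"
      using S' by simp
  qed
  have [measurable]: "(*) \<omega> \<in> borel_measurable borel"
    by simp
  have A: "?A \<in> sets borel" "bounded ?A"
  proof -
    show "?A \<in> sets borel"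
      using measurable_sets[of "(*) \<omega>" borel borel ?B] by simp
    obtain b where "\<forall>x\<in>?B. cmod x \<le> b"
      using bounded_box[of l u] unfolding bounded_iff by blast
    then show "bounded ?A"
      unfolding bounded_iff using assms by (intro exI[of _ b]) (auto simp: norm_mult)
  qed
  have image: "?R ` (?P -` ?A) = ?P -` ?B"
  proof -
    have "y \<in> ?R ` (?P -` ?A)" if "?P y \<in> ?B" for y
    proof (rule image_eqI)
      have ne: "\<omega> \<noteq> 0" using assms by auto
      then have "\<omega> * (?P y / \<omega>) = ?P y" by simp
      then show "y = ?R (?J (?P y / \<omega>))" unfolding PJ by (simp only: JP)
      show "?J (?P y / \<omega>) \<in> ?P -` ?A" unfolding vimage_eq PJ using that ne by simp
    qed
    moreover have "?P (?R x) \<in> ?B" if "?P x \<in> ?A" for x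
      unfolding PJ using that by simp
    ultimately show ?thesis by blast
  qed
  have "emeasure (distr lborel borel ((*) \<omega>)) ?B = emeasure lborel ?A"
    by (subst emeasure_distr) auto
  also have "\<dots> = emeasure lborel ?B"
    unfolding em[OF A] em[OF borel_open[OF open_box] bounded_box]
    using measure_orthogonal_image[OF R lm[OF A]] unfolding image by (rule arg_cong[OF sym])
  also have "\<dots> = (\<Prod>b\<in>Basis. (u - l) \<bullet> b)"
    using le by simp
  finally show "emeasure (distr lborel borel ((*) \<omega>)) ?B = (\<Prod>b\<in>Basis. (u - l) \<bullet> b)" .
qed simp

section \<open>Integration against normalized area measure on the disc\<close>

lemma space_disc_area [simp]: "space disc_area = unit_disc"
  by (simp add: disc_area_def space_restrict_space)

lemma finite_measure_disc_area: "finite_measure disc_area"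
  by (rule finite_measureI) (simp add: emeasure_disc_area)

lemma borel_measurable_disc_area:
  assumes "f \<in> borel_measurable borel"
  shows "f \<in> borel_measurable disc_area"
  using assms unfolding disc_area_def uniform_measure_def
  by (auto intro!: measurable_restrict_space1 measurable_completion)

lemma measure_unit_disc_pos: "0 < measure lborel unit_disc"
  using content_ball_pos[of 1 "0::complex"] by simp

text \<open>Moves integrals to \<open>lborel\<close>, where variables can be changed: the uniform
  measure is a constant density on the disc, and completion does not affect integrals of Borel
  functions.\<close>

lemma integral_disc_area:
  fixes f :: "complex \<Rightarrow> 'b::{banach, second_countable_topology}"
  assumes [measurable]: "f \<in> borel_measurable borel"
  shows "(LINT z|disc_area. f z) =
    (LINT z|lborel. indicator unit_disc z *\<^sub>R f z) /\<^sub>R measure lborel unit_disc"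
proof -
  let ?V = "measure lborel unit_disc"
  have V: "emeasure (lebesgue_on unit_disc) unit_disc = ennreal ?V"
    using emeasure_lborel_ball_finite[of "0::complex" 1]
    by (simp add: emeasure_restrict_space emeasure_eq_ennreal_measure measure_restrict_space)
  have density: "disc_area = density (lebesgue_on unit_disc) (\<lambda>z. ennreal (indicator unit_disc z / ?V))"
    unfolding disc_area_def uniform_measure_def V
    using measure_unit_disc_pos
    by (intro arg_cong2[where f=density] refl ext) (auto simp: divide_ennreal[symmetric] split: split_indicator)
  have [measurable]: "f \<in> borel_measurable lebesgue"
    by (rule measurable_completion) simp
  have "(LINT z|disc_area. f z) =
      (LINT z|lebesgue_on unit_disc. (indicator unit_disc z / ?V) *\<^sub>R f z)"
    unfolding density
  proof (rule integral_density)
    show "(\<lambda>z. indicat_real unit_disc z / ?V) \<in> borel_measurable (lebesgue_on unit_disc)"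
      by (rule measurable_restrict_space1, rule measurable_completion)
        (auto intro!: borel_measurable_divide borel_measurable_indicator)
  qed (auto intro: measurable_restrict_space1)
  also have "\<dots> = (LINT z|lebesgue. (indicator unit_disc z *\<^sub>R f z) /\<^sub>R ?V)"
  proof (subst integral_restrict_space)
    show "(LINT z|lebesgue. indicat_real unit_disc z *\<^sub>R (indicat_real unit_disc z / ?V) *\<^sub>R f z) =
        (LINT z|lebesgue. (indicat_real unit_disc z *\<^sub>R f z) /\<^sub>R ?V)"
      by (rule Bochner_Integration.integral_cong) (simp_all add: divide_inverse indicator_def)
  qed simp
  also have "\<dots> = (LINT z|lborel. indicator unit_disc z *\<^sub>R f z) /\<^sub>R ?V"
  proof (subst integral_completion)
    show "(\<lambda>z. (indicat_real unit_disc z *\<^sub>R f z) /\<^sub>R ?V) \<in> borel_measurable lborel"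
      using borel_measurable_indicator[of unit_disc lborel] assms
      by (intro borel_measurable_scaleR) simp_all
  qed (rule integral_scaleR_right)
  finally show ?thesis .
qed

lemma integral_disc_area_rotation:
  fixes f :: "complex \<Rightarrow> 'b::{banach, second_countable_topology}"
  assumes [measurable]: "f \<in> borel_measurable borel" and \<omega>: "cmod \<omega> = 1"
  shows "(LINT z|disc_area. f (\<omega> * z)) = (LINT z|disc_area. f z)"
proof -
  let ?g = "\<lambda>z. indicator unit_disc z *\<^sub>R f z"
  have g: "?g \<in> borel_measurable borel"
    using borel_measurable_indicator[of unit_disc borel] assms
    by (intro borel_measurable_scaleR) simp_all
  have "(LINT z|lborel. ?g z) = (LINT z|distr lborel borel ((*) \<omega>). ?g z)"
    by (simp add: distr_lborel_rotation[OF \<omega>])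
  also have "\<dots> = (LINT z|lborel. ?g (\<omega> * z))"
    by (rule integral_distr) (use g in simp_all)
  also have "\<dots> = (LINT z|lborel. indicator unit_disc z *\<^sub>R f (\<omega> * z))"
    by (rule Bochner_Integration.integral_cong) (simp_all add: indicator_def norm_mult \<omega>)
  finally show ?thesis
    by (simp add: integral_disc_area)
qed

text \<open>Dilation by \<open>r\<close> has Jacobian \<open>r\<^sup>2\<close> in real dimension two
  and carries the unit disc onto \<open>ball 0 r\<close>; the normalizing area is the same on both
  sides.\<close>

lemma integral_disc_area_scale:
  fixes f :: "complex \<Rightarrow> 'b::{banach, second_countable_topology}"
  assumes [measurable]: "f \<in> borel_measurable borel" and r: "0 < r" "r \<le> 1"
  shows "(LINT z|disc_area. indicator (ball 0 r) z *\<^sub>R f z) =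
    r\<^sup>2 *\<^sub>R (LINT z|disc_area. f (of_real r * z))"
proof -
  let ?g = "\<lambda>z. indicator (ball 0 r) z *\<^sub>R f z"
  have g: "?g \<in> borel_measurable borel"
    using borel_measurable_indicator[of "ball 0 r" borel] assms
    by (intro borel_measurable_scaleR) simp_all
  have "(LINT z|lborel. ?g z) =
      (LINT z|density (distr lborel borel (\<lambda>z. 0 + r *\<^sub>R z)) (\<lambda>_. ennreal (r\<^sup>2)). ?g z)"
    using lborel_affine[of r "0::complex"] r by simp
  also have "\<dots> = (LINT z|distr lborel borel (\<lambda>z. 0 + r *\<^sub>R z). r\<^sup>2 *\<^sub>R ?g z)"
    by (rule integral_density) (use g in \<open>simp_all del: scaleR_scaleR\<close>)
  also have "\<dots> = (LINT z|lborel. r\<^sup>2 *\<^sub>R ?g (0 + r *\<^sub>R z))"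
    by (rule integral_distr) (use borel_measurable_scaleR[OF borel_measurable_const g, of "r\<^sup>2"] in
      \<open>simp_all del: scaleR_scaleR\<close>)
  also have "\<dots> = (LINT z|lborel. r\<^sup>2 *\<^sub>R (indicator unit_disc z *\<^sub>R f (of_real r * z)))"
    using r by (intro Bochner_Integration.integral_cong)
      (simp_all add: indicator_def scaleR_conv_of_real norm_mult)
  also have "\<dots> = r\<^sup>2 *\<^sub>R (LINT z|lborel. indicator unit_disc z *\<^sub>R f (of_real r * z))"
    by (rule integral_scaleR_right)
  finally have *: "(LINT z|lborel. ?g z) = \<dots>" .
  \<comment> \<open>As \<open>r \<le> 1\<close>, the smaller ball lies in the unit disc, so the
    second cut-off changes nothing.\<close>
  have "(LINT z|lborel. indicator unit_disc z *\<^sub>R ?g z) = (LINT z|lborel. ?g z)"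
    using r by (intro Bochner_Integration.integral_cong) (simp_all add: indicator_def)
  then show ?thesis
    using g by (simp add: integral_disc_area *)
qed

lemma measure_disc_area [simp]: "measure disc_area unit_disc = 1"
  using emeasure_disc_area by (simp add: measure_def)

lemma integral_disc_area_const:
  fixes c :: "'b::{banach, second_countable_topology}"
  shows "(LINT z|disc_area. c) = c"
  by simp

lemma integrable_disc_area_bounded:
  fixes f :: "complex \<Rightarrow> 'b::{banach, second_countable_topology}"
  assumes "f \<in> borel_measurable borel" "\<And>z. z \<in> unit_disc \<Longrightarrow> norm (f z) \<le> B"
  shows "integrable disc_area f"
proof -
  interpret finite_measure disc_area by (rule finite_measure_disc_area)
  show ?thesis
    by (rule integrable_const_bound[OF AE_I2 borel_measurable_disc_area]) (use assms in simp_all)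
qed

lemma borel_measurable_cnj: "cnj \<in> borel_measurable borel"
  by (intro borel_measurable_continuous_onI continuous_intros)

section \<open>Moments of the area measure\<close>

lemma integral_disc_area_monomial_orthogonal:
  assumes "n \<noteq> m"
  shows "(LINT z|disc_area. z ^ n * cnj z ^ m) = 0"
proof -
  \<comment> \<open>Rotating by this angle multiplies the monomial by \<open>-1\<close>.\<close>
  define \<theta> where "\<theta> = pi / (real n - real m)"
  have "cis \<theta> ^ n * cnj (cis \<theta>) ^ m = cis (real n * \<theta>) * cis (- (real m * \<theta>))"
    by (simp only: Complex.DeMoivre cis_cnj mult_minus_right)
  also have "\<dots> = cis ((real n - real m) * \<theta>)"
    by (simp add: cis_mult algebra_simps)
  also have "\<dots> = -1"
    using assms by (simp add: \<theta>_def)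
  finally have \<theta>: "cis \<theta> ^ n * cnj (cis \<theta>) ^ m = -1" .
  have "(\<lambda>z. z ^ n * cnj z ^ m) \<in> borel_measurable borel"
    using borel_measurable_cnj by (intro borel_measurable_times borel_measurable_power) simp_all
  then have "(LINT z|disc_area. z ^ n * cnj z ^ m)
      = (LINT z|disc_area. (cis \<theta> * z) ^ n * cnj (cis \<theta> * z) ^ m)"
    by (rule integral_disc_area_rotation[symmetric]) simp
  also have "\<dots> = (LINT z|disc_area. - (z ^ n * cnj z ^ m))"
  proof (rule Bochner_Integration.integral_cong)
    show "(cis \<theta> * z) ^ n * cnj (cis \<theta> * z) ^ m = - (z ^ n * cnj z ^ m)" for z
      using arg_cong[OF \<theta>, of "\<lambda>x. x * (z ^ n * cnj z ^ m)"]
      by (simp add: power_mult_distrib mult_ac)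
  qed simp
  \<comment> \<open>The integral equals its own negative.\<close>
  finally show ?thesis by simp
qed

text \<open>
  Integrating over the annulus \<open>r \<le> \<bar>z\<bar> < 1\<close> instead of using polar coordinates: by scaling, that
  integral is \<open>1 - r ^ (2 * n + 2)\<close> times the whole one, while the integrand lies between
  \<open>r ^ (2 * n)\<close> and \<open>1\<close> there. Divide by the area \<open>1 - r\<^sup>2\<close> and let \<open>r \<rightarrow> 1\<close>.
\<close>

lemma integral_disc_area_cmod_power:
  "(LINT z|disc_area. cmod z ^ (2 * n)) = 1 / (real n + 1)"
proof -
  let ?f = "\<lambda>z. cmod z ^ (2 * n)"
  let ?I = "LINT z|disc_area. ?f z"
  have f: "?f \<in> borel_measurable borel" by simp
  have int_f: "integrable disc_area ?f"
    by (rule integrable_disc_area_bounded[OF f, where B = 1]) (simp add: power_le_one)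
  have bounds: "r ^ (2 * n) \<le> ?I * (\<Sum>k\<le>n. r ^ (2 * k)) \<and> ?I * (\<Sum>k\<le>n. r ^ (2 * k)) \<le> 1"
    if r: "0 < r" "r < 1" for r :: real
  proof -
    let ?i = "\<lambda>z. indicat_real (ball 0 r) z"
    have im: "?i \<in> borel_measurable borel"
      by (rule borel_measurable_indicator) simp
    have int_i: "integrable disc_area ?i"
      by (rule integrable_disc_area_bounded[OF im, where B = 1]) (simp add: indicator_def)
    have one: "integrable disc_area (\<lambda>z. 1::real)"
      by (rule integrable_disc_area_bounded[where B = 1]) simp_all
    have int_if: "integrable disc_area (\<lambda>z. ?i z *\<^sub>R ?f z)"
      by (rule integrable_disc_area_bounded[where B = 1], rule borel_measurable_scaleR[OF im f])
        (simp add: indicator_def power_le_one)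
    have int_1i: "integrable disc_area (\<lambda>z. 1 - ?i z)"
      by (rule Bochner_Integration.integrable_diff[OF one int_i])
    then have int_mult: "integrable disc_area (\<lambda>z. r ^ (2 * n) * (1 - ?i z))"
      by (rule integrable_mult_right)
    have int_fif: "integrable disc_area (\<lambda>z. ?f z - ?i z *\<^sub>R ?f z)"
      by (rule Bochner_Integration.integrable_diff[OF int_f int_if])
    have I_i: "(LINT z|disc_area. ?i z) = r\<^sup>2"
      using integral_disc_area_scale[of "\<lambda>_. 1::real" r] r by simp
    have "(LINT z|disc_area. ?i z *\<^sub>R ?f z) = r\<^sup>2 * (LINT z|disc_area. ?f (of_real r * z))"
      using integral_disc_area_scale[OF f, of r] r by simp
    also have "\<dots> = r ^ (2 * Suc n) * ?I"
      using r by (simp add: norm_mult power_mult_distrib power_add power2_eq_square)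
    finally have "(LINT z|disc_area. ?f z - ?i z *\<^sub>R ?f z) = ?I * (1 - r ^ (2 * Suc n))"
      using int_f int_if by (simp add: algebra_simps)
    \<comment> \<open>Splitting off \<open>1 - r\<^sup>2\<close>, the normalized area of the
      annulus, leaves a sum that tends to \<open>n + 1\<close> as r tends to 1.\<close>
    also have "1 - r ^ (2 * Suc n) = (1 - r\<^sup>2) * (\<Sum>k\<le>n. r ^ (2 * k))"
      using one_diff_power_eq[of "r\<^sup>2" "Suc n"]
      by (simp only: power_mult lessThan_Suc_atMost)
    finally have eq: "(LINT z|disc_area. ?f z - ?i z *\<^sub>R ?f z) =
      (1 - r\<^sup>2) * (?I * (\<Sum>k\<le>n. r ^ (2 * k)))" by (simp add: mult_ac)
    have "(LINT z|disc_area. r ^ (2 * n) * (1 - ?i z)) \<le> (LINT z|disc_area. ?f z - ?i z *\<^sub>R ?f z)"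
    proof (rule integral_mono)
      show "r ^ (2 * n) * (1 - ?i z) \<le> ?f z - ?i z *\<^sub>R ?f z" for z
        using r by (auto simp: indicator_def intro!: power_mono)
    qed (simp_all only: int_mult int_1i int_fif)
    moreover have "(LINT z|disc_area. ?f z - ?i z *\<^sub>R ?f z) \<le> (LINT z|disc_area. 1 - ?i z)"
    proof (rule integral_mono)
      show "?f z - ?i z *\<^sub>R ?f z \<le> 1 - ?i z" if "z \<in> space disc_area" for z
        using that by (auto simp: indicator_def power_le_one)
    qed (simp_all only: int_mult int_1i int_fif)
    moreover have "r\<^sup>2 < 1"
      using r by (simp add: power_less_one_iff)
    ultimately show ?thesis
      using int_i one I_i unfolding eq by (simp add: mult.commute)
  qed
  have near: "\<forall>\<^sub>F r in at_left (1::real). 0 < r \<and> r < 1"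
    using eventually_at_left[of 0 "1::real"] by force
  have "((\<lambda>r. ?I * (\<Sum>k\<le>n. r ^ (2 * k))) \<longlongrightarrow> ?I * (\<Sum>k\<le>n. 1 ^ (2 * k))) (at_left 1)"
    by (intro tendsto_intros)
  then have lim: "((\<lambda>r. ?I * (\<Sum>k\<le>n. r ^ (2 * k))) \<longlongrightarrow> ?I * (real n + 1)) (at_left 1)"
    by (simp add: add.commute)
  have lim': "((\<lambda>r::real. r ^ (2 * n)) \<longlongrightarrow> 1 ^ (2 * n)) (at_left 1)"
    by (intro tendsto_intros)
  have "?I * (real n + 1) \<le> 1"
    by (rule tendsto_upperbound[OF lim]) (use near bounds in \<open>auto elim!: eventually_mono\<close>)
  moreover have "1 ^ (2 * n) \<le> ?I * (real n + 1)"
    by (rule tendsto_le[OF _ lim lim']) (use near bounds in \<open>auto elim!: eventually_mono\<close>)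
  ultimately have "?I * (real n + 1) = 1" by simp
  then show ?thesis by (simp add: field_simps)
qed

lemma integral_disc_area_monomial:
  "(LINT z|disc_area. z ^ n * cnj z ^ m) = (if n = m then 1 / of_nat (Suc n) else 0)"
proof (cases "n = m")
  case True
  have "(LINT z|disc_area. z ^ n * cnj z ^ n) = (LINT z|disc_area. complex_of_real (cmod z ^ (2 * n)))"
    by (simp only: power_mult of_real_power[of _ n] complex_norm_square power_mult_distrib)
  also have "\<dots> = 1 / of_nat (Suc n)"
    by (simp only: integral_complex_of_real integral_disc_area_cmod_power) (simp add: add.commute)
  finally show ?thesis using True by simp
qed (simp add: integral_disc_area_monomial_orthogonal)

section \<open>Power series of the kernel and its reproducing property\<close>

text \<open>Term-by-term integration of the differentiated geometric series in
  \<open>a * u z\<close>. It is applied with \<open>u\<close> the conjugation and with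
  \<open>u\<close> the identity, once for each kernel factor.\<close>

lemma sums_integral_disc_area_kernel:
  fixes h u :: "complex \<Rightarrow> complex"
  assumes h: "h \<in> borel_measurable borel" "\<And>z. z \<in> unit_disc \<Longrightarrow> cmod (h z) \<le> B"
    and u: "u \<in> borel_measurable borel" "\<And>z. z \<in> unit_disc \<Longrightarrow> cmod (u z) \<le> 1"
    and a: "cmod a < 1"
  shows "(\<lambda>m. of_nat (Suc m) * a ^ m * (LINT z|disc_area. h z * u z ^ m))
    sums (LINT z|disc_area. h z * (1 / (1 - a * u z)\<^sup>2))"
proof -
  let ?f = "\<lambda>m z. of_nat (Suc m) * a ^ m * (h z * u z ^ m)"
  \<comment> \<open>A majorant independent of \<open>z\<close>, summable because
    \<open>cmod a < 1\<close>; since the measure has mass one, it also bounds the integrals of the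
    norms.\<close>
  let ?M = "\<lambda>m. real (Suc m) * cmod a ^ m * B"
  have sumM: "summable ?M"
    using geometric_deriv_sums[of "cmod a"] a by (intro summable_mult2) (simp add: sums_iff)
  have bound: "cmod (?f m z) \<le> ?M m" if z: "z \<in> unit_disc" for m z
  proof -
    have "cmod (h z) * cmod (u z) ^ m \<le> B * 1"
      using h(2)[OF z] u(2)[OF z] by (intro mult_mono power_le_one order_trans[OF norm_ge_zero h(2)[OF z]]) simp_all
    then have "real (Suc m) * cmod a ^ m * (cmod (h z) * cmod (u z) ^ m) \<le> real (Suc m) * cmod a ^ m * B"
      by (intro mult_left_mono) simp_all
    then show ?thesis
      by (simp only: norm_mult norm_power norm_of_nat)
  qed
  have "?f m \<in> borel_measurable borel" for m
    by (intro borel_measurable_times borel_measurable_power borel_measurable_const h u)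
  then have int: "integrable disc_area (?f m)" for m
    by (rule integrable_disc_area_bounded[OF _ bound])
  have "(\<lambda>m. LINT z|disc_area. ?f m z) sums (LINT z|disc_area. (\<Sum>m. ?f m z))"
  proof (rule sums_integral[OF int])
    show "AE z in disc_area. summable (\<lambda>m. cmod (?f m z))"
      by (rule AE_I2) (rule summable_comparison_test'[OF sumM], use bound in auto)
    have "(LINT z|disc_area. cmod (?f m z)) \<le> ?M m" for m
    proof -
      have "(LINT z|disc_area. cmod (?f m z)) \<le> (LINT z|disc_area. ?M m)"
      proof (rule integral_mono)
        show "integrable disc_area (\<lambda>_. ?M m)"
          by (rule integrable_disc_area_bounded[OF borel_measurable_const order_refl])
      qed (use int[THEN integrable_norm] bound in \<open>simp_all only: space_disc_area\<close>)
      then show ?thesis by (simp only: integral_disc_area_const)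
    qed
    then show "summable (\<lambda>m. LINT z|disc_area. cmod (?f m z))"
      by (intro summable_comparison_test'[OF sumM]) (simp del: of_nat_Suc)
  qed
  moreover have "(LINT z|disc_area. (\<Sum>m. ?f m z)) = (LINT z|disc_area. h z * (1 / (1 - a * u z)\<^sup>2))"
  proof (rule Bochner_Integration.integral_cong[OF refl])
    fix z assume "z \<in> space disc_area"
    then have "cmod (a * u z) < 1"
      using a u(2)[of z] mult_left_le[of "cmod (u z)" "cmod a"] by (simp add: norm_mult)
    from sums_mult[OF geometric_deriv_sums[OF this], of "h z"]
    show "(\<Sum>m. ?f m z) = h z * (1 / (1 - a * u z)\<^sup>2)"
      by (simp add: power_mult_distrib mult_ac sums_iff)
  qed
  moreover have "(LINT z|disc_area. ?f m z) = of_nat (Suc m) * a ^ m * (LINT z|disc_area. h z * u z ^ m)" for m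
    by (rule integral_mult_right_zero)
  ultimately show ?thesis by simp
qed

text \<open>The reproducing property for the kernel at \<open>cnj c\<close>. Taking
  \<open>c = cnj w\<close> gives the norm of the kernel, and \<open>c = cnj w * \<alpha>\<close>
  gives the Berezin transform.\<close>

lemma bergman_reproducing:
  assumes c: "cmod c < 1" and w: "w \<in> unit_disc"
  shows "(LINT z|disc_area. 1 / (1 - c * z)\<^sup>2 * cnj (1 / (1 - cnj w * z)\<^sup>2)) = 1 / (1 - c * w)\<^sup>2"
proof -
  have w1: "cmod w < 1" using w by simp
  \<comment> \<open>The conjugate of the kernel at \<open>w\<close>, a power series in
    \<open>cnj z\<close>.\<close>
  define h where "h z = 1 / (1 - w * cnj z)\<^sup>2" for z
  have mono: "(LINT z|disc_area. h z * z ^ n) = w ^ n" for n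
  proof -
    have "(\<lambda>m. of_nat (Suc m) * w ^ m * (LINT z|disc_area. z ^ n * cnj z ^ m))
        sums (LINT z|disc_area. z ^ n * (1 / (1 - w * cnj z)\<^sup>2))"
      by (rule sums_integral_disc_area_kernel[where B = 1])
        (use borel_measurable_cnj w1 in \<open>simp_all add: norm_power power_le_one\<close>)
    \<comment> \<open>Orthogonality kills every term but \<open>m = n\<close>, where the moment
      \<open>1 / (n + 1)\<close> cancels the coefficient.\<close>
    moreover have "of_nat (Suc m) * w ^ m * (LINT z|disc_area. z ^ n * cnj z ^ m)
        = (if m = n then w ^ n else 0)" for m
      by (simp add: integral_disc_area_monomial del: of_nat_Suc)
    ultimately have "(\<lambda>m. if m = n then w ^ n else 0)
        sums (LINT z|disc_area. z ^ n * (1 / (1 - w * cnj z)\<^sup>2))"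
      by simp
    from sums_unique2[OF sums_single[of n "\<lambda>_. w ^ n"] this] show ?thesis
      by (simp add: h_def)
  qed
  \<comment> \<open>The other kernel is now expanded in \<open>z\<close>; by \<open>mono\<close> its
    terms integrate to those of the same series at \<open>c * w\<close>.\<close>
  have "(\<lambda>n. of_nat (Suc n) * c ^ n * (LINT z|disc_area. h z * z ^ n))
      sums (LINT z|disc_area. h z * (1 / (1 - c * z)\<^sup>2))"
  proof (rule sums_integral_disc_area_kernel[where B = "1 / (1 - cmod w)\<^sup>2"])
    show "h \<in> borel_measurable borel"
      unfolding h_def using borel_measurable_cnj
      by (intro borel_measurable_divide borel_measurable_power borel_measurable_diff
          borel_measurable_times borel_measurable_const)
    show "cmod (h z) \<le> 1 / (1 - cmod w)\<^sup>2" if z: "z \<in> unit_disc" for z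
    proof -
      have "1 - cmod w \<le> cmod (1 - w * cnj z)"
        using norm_triangle_ineq2[of 1 "w * cnj z"] cnj_mult_norm_le[OF w z] by (simp add: norm_mult)
      then show ?thesis
        unfolding h_def norm_divide norm_power norm_one using w1 by (intro frac_le power_mono) auto
    qed
  qed (use c in auto)
  then have "(\<lambda>n. of_nat (Suc n) * (c * w) ^ n) sums (LINT z|disc_area. h z * (1 / (1 - c * z)\<^sup>2))"
    unfolding mono by (simp only: power_mult_distrib mult.assoc)
  moreover have "cmod (c * w) < 1"
    using c w1 mult_strict_mono[of "cmod c" 1 "cmod w" 1] by (simp add: norm_mult)
  ultimately have "(LINT z|disc_area. h z * (1 / (1 - c * z)\<^sup>2)) = 1 / (1 - c * w)\<^sup>2"
    using sums_unique2[OF geometric_deriv_sums] by metis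
  then show ?thesis
    by (simp add: h_def mult.commute)
qed

text \<open>The squared norm is the kernel's value on the diagonal.\<close>

lemma bergman_norm_kernel:
  assumes w: "w \<in> unit_disc"
  shows "bergman_norm (bergman_kernel w) = 1 / (1 - (cmod w)\<^sup>2)"
proof -
  have lt: "(cmod w)\<^sup>2 < 1"
    using w by (simp add: power_less_one_iff)
  have "complex_of_real (LINT z|disc_area. (cmod (bergman_kernel w z))\<^sup>2)
      = (LINT z|disc_area. 1 / (1 - cnj w * z)\<^sup>2 * cnj (1 / (1 - cnj w * z)\<^sup>2))"
    unfolding integral_complex_of_real[symmetric]
    by (rule Bochner_Integration.integral_cong)
      (simp_all only: complex_norm_square space_disc_area bergman_kernel_def restrict_apply')
  also have "\<dots> = 1 / (1 - cnj w * w)\<^sup>2"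
    using w by (intro bergman_reproducing) simp_all
  also have "\<dots> = of_real ((1 / (1 - (cmod w)\<^sup>2))\<^sup>2)"
    by (simp only: mult.commute[of "cnj w" w] complex_norm_square[symmetric])
      (simp add: power_divide)
  finally have "(LINT z|disc_area. (cmod (bergman_kernel w z))\<^sup>2) = (1 / (1 - (cmod w)\<^sup>2))\<^sup>2"
    by (simp only: of_real_eq_iff)
  then show ?thesis
    unfolding bergman_norm_def using lt by simp
qed

section \<open>The Berezin range as a curve\<close>

text \<open>The parameter \<open>t\<close> stands for \<open>(cmod w)\<^sup>2\<close>.\<close>

definition berezin_curve :: "complex \<Rightarrow> real \<Rightarrow> complex" where
  "berezin_curve \<alpha> t = (1 - of_real t)\<^sup>2 / (1 - \<alpha> * of_real t)\<^sup>2"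

text \<open>Composition with the dilation turns the kernel at \<open>w\<close> into the kernel at
  \<open>cnj \<alpha> * w\<close>, whose inner product with the kernel at \<open>w\<close> is again
  a kernel value.\<close>

lemma berezin_composition_operator:
  assumes \<alpha>: "\<alpha> \<in> cball 0 1" and \<phi>: "\<And>z. z \<in> unit_disc \<Longrightarrow> \<phi> z = \<alpha> * z" and w: "w \<in> unit_disc"
  shows "bergman_inner (composition_operator \<phi> (normalized_kernel w)) (normalized_kernel w)
    = berezin_curve \<alpha> ((cmod w)\<^sup>2)"
proof -
  let ?t = "(cmod w)\<^sup>2"
  let ?N = "complex_of_real (1 / (1 - ?t))"
  have "?t < 1" using w by (simp add: power_less_one_iff)
  then have "1 / (1 / (1 - ?t) * (1 / (1 - ?t))) = (1 - ?t)\<^sup>2"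
    by (simp add: power2_eq_square)
  from arg_cong[OF this, of complex_of_real]
  \<comment> \<open>Each argument of the inner product is divided by the norm, which produces the
    numerator of the curve.\<close>
  have N: "1 / (?N * ?N) = (1 - of_real ?t)\<^sup>2"
    by (simp only: of_real_mult of_real_divide of_real_diff of_real_1 of_real_power)
  have c: "cmod (cnj w * \<alpha>) < 1"
    using w \<alpha> mult_left_le[of "cmod \<alpha>" "cmod w"] by (simp add: norm_mult)
  have k: "normalized_kernel w z = 1 / (1 - cnj w * z)\<^sup>2 / ?N" if "z \<in> unit_disc" for z
    unfolding normalized_kernel_def bergman_norm_kernel[OF w]
    using that by (simp only: bergman_kernel_def restrict_apply')
  have "\<alpha> * z \<in> unit_disc" if "z \<in> unit_disc" for z
    using that \<alpha> mult_right_le_one_le[of "cmod z" "cmod \<alpha>"] by (simp add: norm_mult mult.commute)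
  then have "bergman_inner (composition_operator \<phi> (normalized_kernel w)) (normalized_kernel w)
      = (LINT z|disc_area. 1 / (?N * ?N) *
          (1 / (1 - (cnj w * \<alpha>) * z)\<^sup>2 * cnj (1 / (1 - cnj w * z)\<^sup>2)))"
    unfolding bergman_inner_def
  proof (intro Bochner_Integration.integral_cong[OF refl])
    fix z assume "z \<in> space disc_area"
    then have z: "z \<in> unit_disc" by simp
    assume "\<And>z. z \<in> unit_disc \<Longrightarrow> \<alpha> * z \<in> unit_disc"
    then have \<alpha>z: "\<alpha> * z \<in> unit_disc" using z by blast
    have "composition_operator \<phi> (normalized_kernel w) z = normalized_kernel w (\<alpha> * z)"
      using normalized_kernel_in_bergman_space[OF w] z \<phi>[OF z]
      by (simp only: composition_operator_def restrict_apply')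
    then show "composition_operator \<phi> (normalized_kernel w) z * cnj (normalized_kernel w z) =
        1 / (?N * ?N) * (1 / (1 - (cnj w * \<alpha>) * z)\<^sup>2 * cnj (1 / (1 - cnj w * z)\<^sup>2))"
      by (simp only: k[OF z] k[OF \<alpha>z]) (simp add: mult_ac)
  qed
  also have "\<dots> = 1 / (?N * ?N) * (1 / (1 - (cnj w * \<alpha>) * w)\<^sup>2)"
    using bergman_reproducing[OF c w] by (simp only: integral_mult_right_zero)
  also have "\<dots> = (1 - of_real ?t)\<^sup>2 * (1 / (1 - (cnj w * \<alpha>) * w)\<^sup>2)"
    by (simp only: N)
  also have "(cnj w * \<alpha>) * w = \<alpha> * of_real ?t"
    by (simp only: complex_norm_square mult_ac)
  finally show ?thesis by (simp add: berezin_curve_def)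
qed

lemma berezin_range_composition_operator:
  fixes \<alpha> :: complex and \<phi> :: "complex \<Rightarrow> complex"
  assumes "\<alpha> \<in> cball 0 1" "\<And>z. z \<in> unit_disc \<Longrightarrow> \<phi> z = \<alpha> * z"
  shows "berezin_range (composition_operator \<phi>) = berezin_curve \<alpha> ` {0..<1}"
proof -
  have "berezin_range (composition_operator \<phi>) = (\<lambda>w. berezin_curve \<alpha> ((cmod w)\<^sup>2)) ` unit_disc"
    unfolding berezin_range_def Setcompr_eq_image
    by (intro image_cong refl berezin_composition_operator assms)
  also have "\<dots> = berezin_curve \<alpha> ` ((\<lambda>w. (cmod w)\<^sup>2) ` unit_disc)"
    by (simp add: image_image)
  also have "(\<lambda>w. (cmod w)\<^sup>2) ` unit_disc = {0..<1}"
  proof -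
    have "t \<in> (\<lambda>w. (cmod w)\<^sup>2) ` unit_disc" if "t \<in> {0..<1}" for t
      using that by (intro image_eqI[of _ _ "of_real (sqrt t)"]) auto
    then show ?thesis by (auto simp: power_less_one_iff)
  qed
  finally show ?thesis .
qed

section \<open>Convexity of the curve\<close>

lemma berezin_curve_denominator_nonzero:
  fixes \<alpha> :: complex
  assumes "\<alpha> \<in> cball 0 1" "t \<in> {0..<1}"
  shows "1 - \<alpha> * of_real t \<noteq> 0"
proof
  assume "1 - \<alpha> * of_real t = 0"
  then have "cmod (\<alpha> * of_real t) = 1" by (metis eq_iff_diff_eq_0 norm_one)
  moreover have "cmod (\<alpha> * of_real t) \<le> t"
    using assms mult_right_le_one_le[of t "cmod \<alpha>"] by (simp add: norm_mult mult.commute)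
  ultimately show False using assms(2) by simp
qed

lemma convex_berezin_curve_real:
  assumes "\<alpha> \<in> cball 0 1" "\<alpha> \<in> \<real>"
  shows "convex (berezin_curve \<alpha> ` {0..<1})"
proof -
  have "continuous_on {0..<1} (\<lambda>t. Re (berezin_curve \<alpha> t))"
    unfolding berezin_curve_def using berezin_curve_denominator_nonzero[OF assms(1)]
    by (intro continuous_intros) auto
  then have "connected ((\<lambda>t. Re (berezin_curve \<alpha> t)) ` {0..<1})"
    by (rule connected_continuous_image) simp
  \<comment> \<open>In the real line connected sets are intervals, hence convex; the linear
    embedding carries this to the complex plane.\<close>
  then have "convex ((\<lambda>t. Re (berezin_curve \<alpha> t)) ` {0..<1})"
    by (simp only: is_interval_connected_1[symmetric] is_interval_convex_1)
  from convex_linear_image[OF bounded_linear.linear[OF bounded_linear_of_real] this]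
  have "convex (complex_of_real ` (\<lambda>t. Re (berezin_curve \<alpha> t)) ` {0..<1})" .
  moreover have "complex_of_real (Re (berezin_curve \<alpha> t)) = berezin_curve \<alpha> t" for t
    unfolding berezin_curve_def using assms(2) by (intro of_real_Re) simp
  ultimately show ?thesis by (simp add: image_image)
qed

lemma convex_berezin_curve_imp_real:
  assumes \<alpha>: "\<alpha> \<in> cball 0 1" and conv: "convex (berezin_curve \<alpha> ` {0..<1})"
  shows "\<alpha> \<in> \<real>"
proof (rule ccontr)
  assume nreal: "\<alpha> \<notin> \<real>"
  \<comment> \<open>At \<open>1/2\<close> the curve has the simple value
    \<open>1 / (2 - \<alpha>)\<^sup>2\<close>, easily seen to be nonreal.\<close>
  define p where "p = berezin_curve \<alpha> (1/2)"
  define d where "d = p - 1"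
  \<comment> \<open>For real \<open>t\<close>, up to the factor \<open>2 * \<i>\<close>, this is
    \<open>Im ((berezin_curve \<alpha> t - 1) * cnj d)\<close> cleared of denominators.\<close>
  define Q :: "complex poly" where
    "Q = smult (cnj d) (([:1, -1:]\<^sup>2 - [:1, -\<alpha>:]\<^sup>2) * [:1, - cnj \<alpha>:]\<^sup>2)
       - smult d (([:1, -1:]\<^sup>2 - [:1, - cnj \<alpha>:]\<^sup>2) * [:1, -\<alpha>:]\<^sup>2)"
  have p: "p = 1 / (2 - \<alpha>)\<^sup>2"
    using berezin_curve_denominator_nonzero[OF \<alpha>, of "1/2"]
    by (simp add: p_def berezin_curve_def field_simps power2_eq_square)
  have "p \<notin> \<real>"
  proof
    assume "p \<in> \<real>"
    then have "1 / p \<in> \<real>" by simp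
    then have "(2 - \<alpha>)\<^sup>2 \<in> \<real>" by (simp add: p)
    \<comment> \<open>The imaginary part of the square is \<open>-2\<close> times this product, and
      the second factor is positive.\<close>
    then have "Im \<alpha> * (2 - Re \<alpha>) = 0"
      by (simp add: complex_is_Real_iff power2_eq_square algebra_simps)
    moreover have "Re \<alpha> \<le> 1" using \<alpha> complex_Re_le_cmod[of \<alpha>] by simp
    ultimately show False using nreal by (simp add: complex_is_Real_iff)
  qed
  then have dcnj: "cnj d \<noteq> d"
    by (auto simp: d_def complex_is_Real_iff complex_eq_iff)
  have root: "poly Q (of_real t) = 0"
    if t: "t \<in> {0..<1}" and s: "berezin_curve \<alpha> t = 1 + of_real s * d" for t s
  proof -
    let ?N = "(1 - complex_of_real t)\<^sup>2" and ?D = "(1 - \<alpha> * of_real t)\<^sup>2"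
    have "?D \<noteq> 0" using berezin_curve_denominator_nonzero[OF \<alpha> t] by simp
    then have 1: "?N - ?D = of_real s * d * ?D"
      using s by (simp add: berezin_curve_def field_simps)
    \<comment> \<open>Conjugation fixes \<open>?N\<close> and \<open>s\<close>, which are real.
      Hence both products in the value of \<open>Q\<close> equal
      \<open>s * d * cnj d * ?D * cnj ?D\<close> and cancel.\<close>
    have 2: "?N - cnj ?D = of_real s * cnj d * cnj ?D"
      using arg_cong[OF 1, of cnj] by simp
    have "poly Q (of_real t) = cnj d * ((?N - ?D) * cnj ?D) - d * ((?N - cnj ?D) * ?D)"
      by (simp add: Q_def mult.commute)
    also have "\<dots> = 0" unfolding 1 2 by simp
    finally show ?thesis .
  qed
  have "\<exists>t\<in>{0..<1}. berezin_curve \<alpha> t = 1 + of_real s * d" if s: "s \<in> {0..1}" for s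
  proof -
    have "1 \<in> berezin_curve \<alpha> ` {0..<1}"
      by (rule image_eqI[of _ _ 0]) (simp_all add: berezin_curve_def)
    moreover have "p \<in> berezin_curve \<alpha> ` {0..<1}"
      by (simp add: p_def)
    ultimately have "(1 - s) *\<^sub>R 1 + s *\<^sub>R p \<in> berezin_curve \<alpha> ` {0..<1}"
      using s by (intro convexD[OF conv]) auto
    moreover have "(1 - s) *\<^sub>R 1 + s *\<^sub>R p = 1 + of_real s * d"
      by (simp add: d_def scaleR_conv_of_real algebra_simps)
    ultimately show ?thesis by auto
  qed
  then obtain \<tau> where \<tau>: "\<And>s. s \<in> {0..1} \<Longrightarrow> \<tau> s \<in> {0..<1::real}"
      "\<And>s. s \<in> {0..1} \<Longrightarrow> berezin_curve \<alpha> (\<tau> s) = 1 + of_real s * d"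
    by metis
  have "d \<noteq> 0" using dcnj by auto
  \<comment> \<open>As \<open>d \<noteq> 0\<close>, distinct \<open>s\<close> give distinct points
    of the segment, hence distinct parameters; so \<open>Q\<close> has infinitely many
    roots.\<close>
  then have "inj_on (\<lambda>s. complex_of_real (\<tau> s)) {0..1}"
    using \<tau>(2) by (intro inj_onI) (metis add_left_cancel mult_right_cancel of_real_eq_iff)
  then have "infinite ((\<lambda>s. complex_of_real (\<tau> s)) ` {0..1})"
    using finite_imageD infinite_Icc[of 0 "1::real"] by fastforce
  moreover have "(\<lambda>s. complex_of_real (\<tau> s)) ` {0..1} \<subseteq> {x. poly Q x = 0}"
    using root \<tau> by blast
  ultimately have "Q = 0"
    using poly_roots_finite finite_subset by blast
  \<comment> \<open>The point 1 is the excluded end of the parameter range. There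
    \<open>[:1, -1:]\<close> vanishes, and what is left of \<open>Q\<close> is
    \<open>d - cnj d\<close> times a factor that is nonzero for nonreal
    \<open>\<alpha>\<close>.\<close>
  then have "poly Q 1 = 0" by simp
  then have "(d - cnj d) * ((1 - \<alpha>)\<^sup>2 * (1 - cnj \<alpha>)\<^sup>2) = 0"
    by (simp add: Q_def algebra_simps)
  moreover have "\<alpha> \<noteq> 1" "cnj \<alpha> \<noteq> 1"
    using nreal by (auto simp: complex_is_Real_iff)
  ultimately show False using dcnj by simp
qed

theorem theorem5p1:
  fixes \<alpha> :: complex and \<phi> :: "complex \<Rightarrow> complex"
  assumes "\<alpha> \<in> cball 0 1"
    and "\<And>z. z \<in> unit_disc \<Longrightarrow> \<phi> z = \<alpha> * z"
  shows "convex (berezin_range (composition_operator \<phi>)) \<longleftrightarrow>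
         \<alpha> \<in> \<real> \<and> -1 \<le> Re \<alpha> \<and> Re \<alpha> \<le> 1"
proof -
  have "berezin_range (composition_operator \<phi>) = berezin_curve \<alpha> ` {0..<1}"
    by (rule berezin_range_composition_operator) (fact assms)+
  moreover have "\<bar>Re \<alpha>\<bar> \<le> 1"
    using assms(1) abs_Re_le_cmod[of \<alpha>] by simp
  ultimately show ?thesis
    using convex_berezin_curve_real[OF assms(1)] convex_berezin_curve_imp_real[OF assms(1)] by auto
qed

end
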